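(* Let $X$ be a connected rigid digital image, let $id : X \to X$ be the identity map and let $c : X \to X$ be a constant map ($c(x) = x_0$ for all $x \in X$, with $x_0 \in X$ fixed). Then $$HCS(id, c) = S(c) \quad\text{and}\quad MC(id, c) = MF(c).$$
   Context: A digital image is a pair $(X,\kappa)$ with $X \subset \mathbb{Z}^n$ for some $n \in \mathbb{N}$ and $\kappa = \kappa(t,n)$ for some $1 \le t \le n$, where distinct points $p,q \in \mathbb{Z}^n$ are $\kappa(t,n)$-adjacent if at most $t$ of their coordinates differ by $\pm 1$ and all other coordinates coincide. One usually writes $X$ for $(X,\kappa)$. The digital image is viewed as a graph with vertex set $X$ and edges given by $\kappa$. Two disjoint subsets of $X$ are adjacent to each other if some point of one is adjacent to some point of the other. A set is connected if it is not a union of two disjoint non-empty sets that are not adjacent to each other. A function $f:(X,\kappa_1)\to(Y,\kappa_2)$ between digital images is continuous if it maps $\kappa_1$-connected subsets of $X$ to $\kappa_2$-connected subsets of $Y$; equivalently, whenever $x,y\in X$ are $\kappa_1$-adjacent, $f(x)$ and $f(y)$ are equal or $\kappa_2$-adjacent. For $m\in\mathbb{N}$, the digital interval $[0,m]_{\mathbb{Z}} = \{0,1,\dots,m\}$ carries the adjacency in which consecutive integers are adjacent. Continuous functions $f,g : X \to Y$ are (digitally) homotopic, written $f \simeq g$, if there are a positive integer $m$ and a function $H : X \times [0,m]_{\mathbb{Z}} \to Y$ such that $H(x,0) = f(x)$ and $H(x,m) = g(x)$ for all $x\in X$; for each $x\in X$ the map $t \mapsto H(x,t)$ from $[0,m]_{\mathbb{Z}}$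 to $Y$ is continuous; and for each $t \in [0,m]_{\mathbb{Z}}$ the map $x \mapsto H(x,t)$ from $X$ to $Y$ is continuous. A continuous function $f$ is rigid if no continuous map is homotopic to $f$ except $f$ itself. The image $X$ is rigid if its identity map is rigid. $\#A$ denotes the cardinality of a set $A$, and $\mathrm{Fix}(g) = \{x \in X \mid g(x) = x\}$. For continuous $f_1,f_2 : X\to Y$, let $C(f_1,f_2) = \{x\in X \mid f_1(x)=f_2(x)\}$, $$HCS(f_1,f_2) = \{\#C(g_1,g_2) \mid g_1\simeq f_1 \text{ and } g_2 \simeq f_2\},\qquad MC(f_1,f_2) = \min\{\#C(g_1,g_2) \mid g_1\simeq f_1 \text{ and } g_2\simeq f_2\}.$$ For continuous $f : X \to X$, let $S(f) = \{\#\mathrm{Fix}(g) \mid g \simeq f\}$ and $MF(f) = \min\{\#\mathrm{Fix}(g)\mid g\simeq f\}$. *)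

theory Defs
  imports "HOL-Analysis.Finite_Cartesian_Product" "HOL-Library.Extended_Nat"
begin

text \<open>
  A digital image is a set \<open>X\<close> of points of \<open>int ^ 'n\<close> together with an adjacency
  \<open>kappa t\<close>, where \<open>1 \<le> t \<le> CARD('n)\<close>. Connectedness, continuity and homotopy are
  stated for an arbitrary vertex set with an adjacency relation, so that they also apply
  to the digital interval, whose points are of type \<^typ>\<open>int\<close>.

  A function \<open>X \<rightarrow> Y\<close> is a total HOL function of which only the values on \<open>X\<close> are ever used;
  in particular two such functions count as the same if they agree on \<open>X\<close>.
\<close>

definition kappa :: "nat \<Rightarrow> int ^ 'n \<Rightarrow> int ^ 'n \<Rightarrow> bool" where
  "kappa t p q \<longleftrightarrow> p \<noteq> q \<and> card {i. \<bar>p $ i - q $ i\<bar> = 1} \<le> t \<and>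
     (\<forall>i. \<bar>p $ i - q $ i\<bar> \<noteq> 1 \<longrightarrow> p $ i = q $ i)"

definition digital_image :: "(int ^ 'n) set \<Rightarrow> (int ^ 'n \<Rightarrow> int ^ 'n \<Rightarrow> bool) \<Rightarrow> bool" where
  "digital_image X \<kappa> \<longleftrightarrow> (\<exists>t. 1 \<le> t \<and> t \<le> CARD('n) \<and> \<kappa> = kappa t)"

definition adjacent_sets :: "('a \<Rightarrow> 'a \<Rightarrow> bool) \<Rightarrow> 'a set \<Rightarrow> 'a set \<Rightarrow> bool" where
  "adjacent_sets \<kappa> A B \<longleftrightarrow> (\<exists>a\<in>A. \<exists>b\<in>B. \<kappa> a b)"

definition dig_connected :: "('a \<Rightarrow> 'a \<Rightarrow> bool) \<Rightarrow> 'a set \<Rightarrow> bool" where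
  "dig_connected \<kappa> S \<longleftrightarrow>
     \<not> (\<exists>A B. S = A \<union> B \<and> A \<inter> B = {} \<and> A \<noteq> {} \<and> B \<noteq> {} \<and> \<not> adjacent_sets \<kappa> A B)"

definition dig_continuous ::
  "'a set \<Rightarrow> ('a \<Rightarrow> 'a \<Rightarrow> bool) \<Rightarrow> 'b set \<Rightarrow> ('b \<Rightarrow> 'b \<Rightarrow> bool) \<Rightarrow> ('a \<Rightarrow> 'b) \<Rightarrow> bool" where
  "dig_continuous X \<kappa> Y \<mu> f \<longleftrightarrow>
     f ` X \<subseteq> Y \<and> (\<forall>S\<subseteq>X. dig_connected \<kappa> S \<longrightarrow> dig_connected \<mu> (f ` S))"

lemma symp_kappa: "symp (kappa t)"
proof (rule sympI)
  fix p q :: "int ^ 'a"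
  assume pq: "kappa t p q"
  have e: "\<bar>q $ i - p $ i\<bar> = \<bar>p $ i - q $ i\<bar>" for i
    by (rule abs_minus_commute)
  show "kappa t q p"
    unfolding kappa_def
  proof (intro conjI allI impI)
    show "q \<noteq> p" using pq by (auto simp: kappa_def)
    have "{i. \<bar>q $ i - p $ i\<bar> = 1} = {i. \<bar>p $ i - q $ i\<bar> = 1}" using e by presburger
    then show "card {i. \<bar>q $ i - p $ i\<bar> = 1} \<le> t" using pq by (simp add: kappa_def)
    show "q $ i = p $ i" if "\<bar>q $ i - p $ i\<bar> \<noteq> 1" for i
    proof -
      have "p $ i = q $ i" using pq that e[of i] by (simp add: kappa_def)
      then show ?thesis by simp
    qed
  qed
qed

lemma dig_connectedI:
  assumes "\<And>A B. \<lbrakk>S = A \<union> B; A \<inter> B = {}; A \<noteq> {}; B \<noteq> {}\<rbrakk> \<Longrightarrow> adjacent_sets \<kappa> A B"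
  shows "dig_connected \<kappa> S"
  unfolding dig_connected_def
proof (rule notI, elim exE conjE)
  fix A B
  assume "S = A \<union> B" "A \<inter> B = {}" "A \<noteq> {}" "B \<noteq> {}" "\<not> adjacent_sets \<kappa> A B"
  then show False using assms[of A B] by simp
qed

lemma dig_connectedD:
  assumes "dig_connected \<kappa> S" "S = A \<union> B" "A \<inter> B = {}" "A \<noteq> {}" "B \<noteq> {}"
  shows "adjacent_sets \<kappa> A B"
proof (rule ccontr)
  assume "\<not> adjacent_sets \<kappa> A B"
  then have "\<exists>A B. S = A \<union> B \<and> A \<inter> B = {} \<and> A \<noteq> {} \<and> B \<noteq> {} \<and> \<not> adjacent_sets \<kappa> A B"
    using assms(2-5) by (intro exI[of _ A] exI[of _ B] conjI)
  then show False using assms(1) by (simp only: dig_connected_def not_True_eq_False)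
qed

lemma dig_continuous_iff_adjacent:
  assumes "symp \<kappa>"
  shows "dig_continuous X \<kappa> Y \<mu> f \<longleftrightarrow>
    f ` X \<subseteq> Y \<and> (\<forall>x\<in>X. \<forall>y\<in>X. \<kappa> x y \<longrightarrow> f x = f y \<or> \<mu> (f x) (f y))"
proof (intro iffI conjI ballI impI)
  assume c: "dig_continuous X \<kappa> Y \<mu> f"
  then show "f ` X \<subseteq> Y" by (simp only: dig_continuous_def)
  fix x y assume xy: "x \<in> X" "y \<in> X" "\<kappa> x y"
  have "dig_connected \<kappa> {x, y}"
  proof (rule dig_connectedI)
    fix A B assume h: "{x, y} = A \<union> B" "A \<noteq> {}" "B \<noteq> {}"
    have "A \<subseteq> {x, y}" "B \<subseteq> {x, y}" unfolding h(1) by (rule Un_upper1, rule Un_upper2)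
    moreover have "x \<in> A \<union> B" "y \<in> A \<union> B"
      unfolding h(1)[symmetric] by (rule insertI1, rule insertI2, rule insertI1)
    ultimately have "x \<in> A \<and> y \<in> B \<or> x \<in> B \<and> y \<in> A" using h(2,3) by blast
    then show "adjacent_sets \<kappa> A B"
      unfolding adjacent_sets_def using xy(3) sympD[OF assms xy(3)] by blast
  qed
  moreover have "{x, y} \<subseteq> X" using xy by simp
  ultimately have con: "dig_connected \<mu> (f ` {x, y})"
    using c unfolding dig_continuous_def by blast
  show "f x = f y \<or> \<mu> (f x) (f y)"
  proof (cases "f x = f y")
    case False
    then have "adjacent_sets \<mu> {f x} {f y}"
      by (intro dig_connectedD[OF con]) auto
    then show ?thesis by (simp add: adjacent_sets_def)
  qed simp
next
  assume a: "f ` X \<subseteq> Y \<and> (\<forall>x\<in>X. \<forall>y\<in>X. \<kappa> x y \<longrightarrow> f x = f y \<or> \<mu> (f x) (f y))"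
  have "dig_connected \<mu> (f ` S)" if S: "S \<subseteq> X" "dig_connected \<kappa> S" for S
  proof (rule dig_connectedI)
    fix A B assume h: "f ` S = A \<union> B" "A \<inter> B = {}" "A \<noteq> {}" "B \<noteq> {}"
    have "adjacent_sets \<kappa> (S \<inter> f -` A) (S \<inter> f -` B)"
    proof (rule dig_connectedD[OF S(2)])
      show "S = S \<inter> f -` A \<union> S \<inter> f -` B" using h(1) by blast
      show "(S \<inter> f -` A) \<inter> (S \<inter> f -` B) = {}" using h(2) by blast
      have "A \<subseteq> f ` S" "B \<subseteq> f ` S" by (simp_all add: h(1))
      then show "S \<inter> f -` A \<noteq> {}" "S \<inter> f -` B \<noteq> {}" using h(3,4) by blast+
    qed
    then obtain x y where xy: "x \<in> S" "y \<in> S" "f x \<in> A" "f y \<in> B" "\<kappa> x y"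
      unfolding adjacent_sets_def by blast
    then have "f x = f y \<or> \<mu> (f x) (f y)" using a S(1) by blast
    moreover have "f x \<noteq> f y" using xy(3,4) h(2) by (metis IntI empty_iff)
    ultimately show "adjacent_sets \<mu> A B" unfolding adjacent_sets_def using xy(3,4) by blast
  qed
  then show "dig_continuous X \<kappa> Y \<mu> f" using a by (simp add: dig_continuous_def)
qed

definition interval_adj :: "int \<Rightarrow> int \<Rightarrow> bool" where
  "interval_adj i j \<longleftrightarrow> \<bar>i - j\<bar> = 1"

definition dig_homotopic ::
  "'a set \<Rightarrow> ('a \<Rightarrow> 'a \<Rightarrow> bool) \<Rightarrow> 'b set \<Rightarrow> ('b \<Rightarrow> 'b \<Rightarrow> bool) \<Rightarrow> ('a \<Rightarrow> 'b) \<Rightarrow> ('a \<Rightarrow> 'b) \<Rightarrow> bool"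
where
  "dig_homotopic X \<kappa> Y \<mu> f g \<longleftrightarrow>
     dig_continuous X \<kappa> Y \<mu> f \<and> dig_continuous X \<kappa> Y \<mu> g \<and>
     (\<exists>m>0. \<exists>H :: 'a \<Rightarrow> int \<Rightarrow> 'b.
        (\<forall>x\<in>X. H x 0 = f x \<and> H x m = g x) \<and>
        (\<forall>x\<in>X. dig_continuous {0..m} interval_adj Y \<mu> (\<lambda>s. H x s)) \<and>
        (\<forall>s\<in>{0..m}. dig_continuous X \<kappa> Y \<mu> (\<lambda>x. H x s)))"

definition rigid_map ::
  "'a set \<Rightarrow> ('a \<Rightarrow> 'a \<Rightarrow> bool) \<Rightarrow> 'b set \<Rightarrow> ('b \<Rightarrow> 'b \<Rightarrow> bool) \<Rightarrow> ('a \<Rightarrow> 'b) \<Rightarrow> bool" where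
  "rigid_map X \<kappa> Y \<mu> f \<longleftrightarrow>
     dig_continuous X \<kappa> Y \<mu> f \<and> (\<forall>g. dig_homotopic X \<kappa> Y \<mu> g f \<longrightarrow> (\<forall>x\<in>X. g x = f x))"

definition rigid_image :: "'a set \<Rightarrow> ('a \<Rightarrow> 'a \<Rightarrow> bool) \<Rightarrow> bool" where
  "rigid_image X \<kappa> \<longleftrightarrow> rigid_map X \<kappa> X \<kappa> id"

text \<open>
  Digital images may be infinite, where \<^const>\<open>card\<close> would give 0. They are countable, so
  the extended naturals capture all cardinalities of their subsets.
\<close>

definition ecard :: "'a set \<Rightarrow> enat" where
  "ecard A = (if finite A then enat (card A) else \<infinity>)"

definition Fix :: "'a set \<Rightarrow> ('a \<Rightarrow> 'a) \<Rightarrow> 'a set" where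
  "Fix X g = {x \<in> X. g x = x}"

definition coincidence_set :: "'a set \<Rightarrow> ('a \<Rightarrow> 'b) \<Rightarrow> ('a \<Rightarrow> 'b) \<Rightarrow> 'a set" where
  "coincidence_set X f\<^sub>1 f\<^sub>2 = {x \<in> X. f\<^sub>1 x = f\<^sub>2 x}"

definition HCS ::
  "'a set \<Rightarrow> ('a \<Rightarrow> 'a \<Rightarrow> bool) \<Rightarrow> 'b set \<Rightarrow> ('b \<Rightarrow> 'b \<Rightarrow> bool) \<Rightarrow> ('a \<Rightarrow> 'b) \<Rightarrow> ('a \<Rightarrow> 'b) \<Rightarrow> enat set"
where
  "HCS X \<kappa> Y \<mu> f\<^sub>1 f\<^sub>2 = {ecard (coincidence_set X g\<^sub>1 g\<^sub>2) | g\<^sub>1 g\<^sub>2.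
     dig_homotopic X \<kappa> Y \<mu> g\<^sub>1 f\<^sub>1 \<and> dig_homotopic X \<kappa> Y \<mu> g\<^sub>2 f\<^sub>2}"

definition MC ::
  "'a set \<Rightarrow> ('a \<Rightarrow> 'a \<Rightarrow> bool) \<Rightarrow> 'b set \<Rightarrow> ('b \<Rightarrow> 'b \<Rightarrow> bool) \<Rightarrow> ('a \<Rightarrow> 'b) \<Rightarrow> ('a \<Rightarrow> 'b) \<Rightarrow> enat"
where
  "MC X \<kappa> Y \<mu> f\<^sub>1 f\<^sub>2 = (LEAST k. \<exists>g\<^sub>1 g\<^sub>2. k = ecard (coincidence_set X g\<^sub>1 g\<^sub>2) \<and>
     dig_homotopic X \<kappa> Y \<mu> g\<^sub>1 f\<^sub>1 \<and> dig_homotopic X \<kappa> Y \<mu> g\<^sub>2 f\<^sub>2)"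

definition fixed_point_spectrum :: "'a set \<Rightarrow> ('a \<Rightarrow> 'a \<Rightarrow> bool) \<Rightarrow> ('a \<Rightarrow> 'a) \<Rightarrow> enat set" where
  "fixed_point_spectrum X \<kappa> f = {ecard (Fix X g) | g. dig_homotopic X \<kappa> X \<kappa> g f}"

definition MF :: "'a set \<Rightarrow> ('a \<Rightarrow> 'a \<Rightarrow> bool) \<Rightarrow> ('a \<Rightarrow> 'a) \<Rightarrow> enat" where
  "MF X \<kappa> f = (LEAST k. \<exists>g. k = ecard (Fix X g) \<and> dig_homotopic X \<kappa> X \<kappa> g f)"

end

theory Submission
  imports Defs
begin

text \<open>
  Rigidity of \<open>X\<close> forces every \<open>g\<^sub>1 \<simeq> id\<close> to agree with the identity on \<open>X\<close>. The
  coincidence set of a pair with \<open>g\<^sub>1 \<simeq> id\<close> and \<open>g\<^sub>2 \<simeq> f\<close> is therefore the fixed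
  point set of \<open>g\<^sub>2\<close>. Conversely, since \<open>id \<simeq> id\<close>, each \<open>g \<simeq> f\<close> occurs as the second
  map of such a pair. Hence the cardinalities of the coincidence sets for \<open>(id, f)\<close> are exactly
  the cardinalities of the fixed point sets for \<open>f\<close>
  (lemma \<open>rigid_image_coincidence_iff_Fix\<close>), and the two minima coincide as well.
\<close>

lemma dig_continuous_const:
  fixes X :: "'a set" and Y :: "'b set"
  assumes "y \<in> Y"
  shows "dig_continuous X \<kappa> Y \<mu> (\<lambda>_. y)"
proof -
  have "dig_connected \<mu> ((\<lambda>_. y) ` S)" for S :: "'a set"
  proof (rule dig_connectedI)
    fix A B
    assume "(\<lambda>_. y) ` S = A \<union> B" "A \<inter> B = {}" "A \<noteq> {}" "B \<noteq> {}"
    then have "A \<subseteq> {y}" "B \<subseteq> {y}" by blast+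
    with \<open>A \<inter> B = {}\<close> \<open>A \<noteq> {}\<close> \<open>B \<noteq> {}\<close> show "adjacent_sets \<mu> A B" by blast
  qed
  with assms show ?thesis unfolding dig_continuous_def by blast
qed

lemma dig_homotopic_refl:
  assumes "dig_continuous X \<kappa> Y \<mu> f"
  shows "dig_homotopic X \<kappa> Y \<mu> f f"
proof -
  have "f x \<in> Y" if "x \<in> X" for x
    using assms that unfolding dig_continuous_def by blast
  then have paths: "\<forall>x\<in>X. dig_continuous {0..1} interval_adj Y \<mu> (\<lambda>_. f x)"
    by (simp add: dig_continuous_const)
  show ?thesis
    unfolding dig_homotopic_def
    using assms paths by (intro conjI exI[of _ "1::int"] exI[of _ "\<lambda>x _. f x"]) simp_all
qed

lemma coincidence_set_eq_Fix:
  assumes "\<forall>x\<in>X. g\<^sub>1 x = x"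
  shows "coincidence_set X g\<^sub>1 g\<^sub>2 = Fix X g\<^sub>2"
  using assms unfolding coincidence_set_def Fix_def by auto

text \<open>
  The sets \<open>HCS\<close> and \<open>fixed_point_spectrum\<close> consist of the \<open>k\<close> with these two properties,
  and \<open>MC\<close> and \<open>MF\<close> are the least such \<open>k\<close>. Stated as an equivalence for each \<open>k\<close>, the
  comparison gives the equality of the sets and that of the minima at once.
\<close>

lemma rigid_image_coincidence_iff_Fix:
  assumes "rigid_image X \<kappa>"
  shows "(\<exists>g\<^sub>1 g\<^sub>2. k = ecard (coincidence_set X g\<^sub>1 g\<^sub>2) \<and>
            dig_homotopic X \<kappa> X \<kappa> g\<^sub>1 id \<and> dig_homotopic X \<kappa> X \<kappa> g\<^sub>2 f)
    \<longleftrightarrow> (\<exists>g. k = ecard (Fix X g) \<and> dig_homotopic X \<kappa> X \<kappa> g f)"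
proof -
  have homotopic_id: "\<forall>x\<in>X. g x = x" if "dig_homotopic X \<kappa> X \<kappa> g id" for g
    using assms that unfolding rigid_image_def rigid_map_def by simp
  have "dig_homotopic X \<kappa> X \<kappa> id id"
    using assms by (intro dig_homotopic_refl) (simp add: rigid_image_def rigid_map_def)
  then show ?thesis
    using coincidence_set_eq_Fix homotopic_id by metis
qed

theorem theorem3p7:
  fixes X :: "(int ^ 'n) set" and \<kappa> :: "int ^ 'n \<Rightarrow> int ^ 'n \<Rightarrow> bool"
    and c :: "int ^ 'n \<Rightarrow> int ^ 'n" and x\<^sub>0 :: "int ^ 'n"
  assumes "digital_image X \<kappa>"
    and "dig_connected \<kappa> X"
    and "rigid_image X \<kappa>"
    and "x\<^sub>0 \<in> X"
    and "\<forall>x\<in>X. c x = x\<^sub>0"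
  shows "HCS X \<kappa> X \<kappa> id c = fixed_point_spectrum X \<kappa> c \<and> MC X \<kappa> X \<kappa> id c = MF X \<kappa> c"
  unfolding HCS_def fixed_point_spectrum_def MC_def MF_def
    rigid_image_coincidence_iff_Fix[OF assms(3)] by (rule conjI refl)+

end
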